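(* Let $m\ge 1$ and let $r\in\{0,1,2,m-1,m\}$ with $0\le r\le m$. Then the binary Reed-Muller code of order $r$ and length $n=2^m\ge 2$ is $\mathbb{Z}_4$-linear.
   Context: The binary Reed-Muller code of order $r$ and length $2^m$ ($0\le r\le m$) is the set of all value vectors $(f(x))_{x\in\mathbb{F}_2^m}$ of Boolean polynomials $f$ in $m$ variables of degree at most $r$. A quaternary linear code of length $N$ is an additive subgroup of $\mathbb{Z}_4^N$. Define $\beta,\gamma:\mathbb{Z}_4\to\mathbb{Z}_2$ by $\beta(0),\beta(1),\beta(2),\beta(3)=0,0,1,1$ and $\gamma(0),\gamma(1),\gamma(2),\gamma(3)=0,1,1,0$, extended componentwise to $\mathbb{Z}_4^N$, and let $\phi:\mathbb{Z}_4^N\to\mathbb{Z}_2^{2N}$, $\phi(a)=(\beta(a),\gamma(a))$. A binary code of length $2N$ is $\mathbb{Z}_4$-linear if its coordinates can be permuted so that it is $\phi(D)$ for some quaternary linear code $D\subseteq\mathbb{Z}_4^N$. *)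

theory Defs
  imports
    "HOL-Library.Z2"
    "HOL-Library.Numeral_Type"
    "HOL-Combinatorics.Permutations"
    "Jordan_Normal_Form.Matrix"
begin

text \<open>
  In a Boolean polynomial \<open>x\<^sub>i\<^sup>2 = x\<^sub>i\<close>, so the monomials are the products of distinct variables.
  A polynomial is represented by its coefficients: \<open>f S\<close> is the coefficient of the product of
  the \<open>x\<^sub>i\<close> with \<open>i \<in> S\<close>. Variables are numbered from 0.
\<close>

type_synonym bool_poly = "nat set \<Rightarrow> bit"

definition bool_polys :: "nat \<Rightarrow> bool_poly set" where
  "bool_polys m = {f. \<forall>S. f S \<noteq> 0 \<longrightarrow> S \<subseteq> {..<m}}"

text \<open>The zero polynomial gets degree 0, so that it has degree at most \<open>r\<close> for every \<open>r\<close>.\<close>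

definition bool_poly_degree :: "bool_poly \<Rightarrow> nat" where
  "bool_poly_degree f = Max (insert 0 (card ` {S. f S \<noteq> 0}))"

definition bool_poly_eval :: "bool_poly \<Rightarrow> bit vec \<Rightarrow> bit" where
  "bool_poly_eval f x = (\<Sum>S\<in>Pow {..<dim_vec x}. f S * (\<Prod>i\<in>S. x $ i))"

text \<open>
  The coordinates of a value vector are ordered by reading the index \<open>k < 2 ^ m\<close> in binary, with
  \<open>x\<^sub>0\<close> the least significant digit.
\<close>

definition point :: "nat \<Rightarrow> nat \<Rightarrow> bit vec" where
  "point m k = vec m (\<lambda>i. of_bool (bit k i))"

lemma bij_betw_point: "bij_betw (point m) {..<2 ^ m} (carrier_vec m)"
proof -
  have inj: "inj_on (point m) {..<2 ^ m}"
  proof (rule inj_onI)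
    fix k l :: nat
    assume k: "k \<in> {..<2 ^ m}" and l: "l \<in> {..<2 ^ m}" and eq: "point m k = point m l"
    have "bit k i = bit l i" if "i < m" for i
    proof -
      have "point m k $ i = point m l $ i" using eq by simp
      then show ?thesis
        using that by (cases "bit k i"; cases "bit l i") (simp_all add: point_def)
    qed
    then have "take_bit m k = take_bit m l"
      by (auto intro!: bit_eqI simp: bit_take_bit_iff)
    then show "k = l" using k l by (simp add: take_bit_nat_eq_self)
  qed
  moreover have "carrier_vec m \<subseteq> point m ` {..<2 ^ m}"
  proof
    fix x :: "bit vec"
    assume x: "x \<in> carrier_vec m"
    define k where "k = take_bit m (horner_sum of_bool (2 :: nat) (map (\<lambda>i. x $ i = 1) [0..<m]))"
    have "x = point m k"
    proof (rule eq_vecI)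
      fix i
      assume "i < dim_vec (point m k)"
      then have "i < m" by (simp add: point_def)
      then show "x $ i = point m k $ i"
        by (cases "x $ i") (simp_all add: point_def k_def bit_take_bit_iff bit_horner_sum_bit_iff)
    qed (use x in \<open>simp add: point_def\<close>)
    moreover have "k < 2 ^ m" by (simp add: k_def)
    ultimately show "x \<in> point m ` {..<2 ^ m}" by auto
  qed
  ultimately show ?thesis by (auto simp: bij_betw_def point_def)
qed

definition value_vec :: "nat \<Rightarrow> bool_poly \<Rightarrow> bit vec" where
  "value_vec m f = vec (2 ^ m) (\<lambda>k. bool_poly_eval f (point m k))"

definition reed_muller :: "nat \<Rightarrow> nat \<Rightarrow> bit vec set" where
  "reed_muller r m = value_vec m ` {f \<in> bool_polys m. bool_poly_degree f \<le> r}"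

definition quaternary_linear_code :: "nat \<Rightarrow> 4 vec set \<Rightarrow> bool" where
  "quaternary_linear_code N D \<longleftrightarrow> subgroup D (monoid_vec TYPE(4) N)"

definition gray_beta :: "4 \<Rightarrow> bit" where
  "gray_beta a = (if a \<in> {2, 3} then 1 else 0)"

definition gray_gamma :: "4 \<Rightarrow> bit" where
  "gray_gamma a = (if a \<in> {1, 2} then 1 else 0)"

lemma gray_beta_values:
  "gray_beta 0 = 0" "gray_beta 1 = 0" "gray_beta 2 = 1" "gray_beta 3 = 1"
  by (simp_all add: gray_beta_def)

lemma gray_gamma_values:
  "gray_gamma 0 = 0" "gray_gamma 1 = 1" "gray_gamma 2 = 1" "gray_gamma 3 = 0"
  by (simp_all add: gray_gamma_def)

definition gray_map :: "4 vec \<Rightarrow> bit vec" where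
  "gray_map a = map_vec gray_beta a @\<^sub>v map_vec gray_gamma a"

definition permute_coords :: "(nat \<Rightarrow> nat) \<Rightarrow> bit vec \<Rightarrow> bit vec" where
  "permute_coords p c = vec (dim_vec c) (\<lambda>i. c $ p i)"

definition Z4_linear :: "nat \<Rightarrow> bit vec set \<Rightarrow> bool" where
  "Z4_linear n C \<longleftrightarrow> C \<subseteq> carrier_vec n \<and>
    (\<exists>N D p. n = 2 * N \<and> quaternary_linear_code N D \<and> p permutes {..<n} \<and>
      permute_coords p ` C = gray_map ` D)"

end

theory Submission
  imports Defs
begin

text \<open>
  Gray's map satisfies \<open>\<phi>(a + b) = \<phi>(a) + \<phi>(b) + (u + \<sigma>u) * (v + \<sigma>v)\<close> for \<open>u = \<phi>(a)\<close>,
  \<open>v = \<phi>(b)\<close>, where \<open>\<sigma>\<close> swaps the two halves of a word and \<open>*\<close> is the componentwise product.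
  On value vectors of Boolean functions \<open>\<sigma>\<close> is the translation \<open>x\<^sub>m\<^sub>-\<^sub>1 \<mapsto> x\<^sub>m\<^sub>-\<^sub>1 + 1\<close>, so \<open>u + \<sigma>u\<close> is
  the derivative of \<open>u\<close> in the last variable: it has degree at most \<open>r - 1\<close> (and vanishes for
  \<open>r = 0\<close>) and does not involve \<open>x\<^sub>m\<^sub>-\<^sub>1\<close>. The product of two derivatives therefore has degree at
  most \<open>min (2 * (r - 1)) (m - 1)\<close>, which is at most \<open>r\<close> for the given values of \<open>r\<close>. Hence the
  preimage of the Reed-Muller code is closed under addition, with no permutation of the
  coordinates.
\<close>

text \<open>These two rules would turn the ring operations of \<^typ>\<open>bit\<close> into bitwise ones.\<close>

declare add_bit_eq_xor [simp del] mult_bit_eq_and [simp del]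

section \<open>A criterion for linearity over the integers modulo 4\<close>

lemma exhaust_Z4: "a = 0 \<or> a = 1 \<or> a = 2 \<or> a = 3" for a :: 4
proof (cases a)
  case (of_int z)
  then have "z = 0 \<or> z = 1 \<or> z = 2 \<or> z = 3" by auto
  with of_int show ?thesis by auto
qed

lemma Z4_sums: "(2 + 2 :: 4) = 0" "(1 + 3 :: 4) = 0" "(3 + 1 :: 4) = 0"
  "(2 + 3 :: 4) = 1" "(3 + 2 :: 4) = 1" "(3 + 3 :: 4) = 2" "(1 + 2 :: 4) = 3" "(2 + 1 :: 4) = 3"
  by simp_all

text \<open>\<open>gray_beta a\<close> is the upper binary digit of \<open>a\<close>, and
  \<open>gray_beta a + gray_gamma a\<close> is the lower one. The product is thus the carry of the
  addition. The lower digits add without correction, so \<open>gray_gamma\<close>, the sum of both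
  digits, picks up the same carry.\<close>

lemma gray_add:
  shows gray_beta_add: "gray_beta (a + b) =
      gray_beta a + gray_beta b + (gray_beta a + gray_gamma a) * (gray_beta b + gray_gamma b)"
    and gray_gamma_add: "gray_gamma (a + b) =
      gray_gamma a + gray_gamma b + (gray_beta a + gray_gamma a) * (gray_beta b + gray_gamma b)"
  using exhaust_Z4[of a] exhaust_Z4[of b]
  by (elim disjE; simp only: gray_beta_values gray_gamma_values Z4_sums add_0_left add_0_right
      one_add_one; simp)+

lemma gray_surj: "\<exists>a. gray_beta a = x \<and> gray_gamma a = y"
proof -
  have "gray_beta (if x = 0 then if y = 0 then 0 else 1 else if y = 0 then 3 else 2) = x \<and>
      gray_gamma (if x = 0 then if y = 0 then 0 else 1 else if y = 0 then 3 else 2) = y"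
    by (cases x; cases y) (simp_all add: gray_beta_values gray_gamma_values)
  then show ?thesis by blast
qed

lemma dim_gray_map [simp]: "dim_vec (gray_map a) = 2 * dim_vec a"
  by (simp add: gray_map_def)

lemma gray_map_index:
  assumes "k < dim_vec a"
  shows "gray_map a $ k = gray_beta (a $ k)" "gray_map a $ (dim_vec a + k) = gray_gamma (a $ k)"
  using assms by (simp_all add: gray_map_def)

lemma vec_eq_halvesI:
  assumes "dim_vec u = 2 * N" "dim_vec v = 2 * N"
    and "\<And>k. k < N \<Longrightarrow> u $ k = v $ k" "\<And>k. k < N \<Longrightarrow> u $ (N + k) = v $ (N + k)"
  shows "u = v"
proof (rule eq_vecI)
  fix i assume "i < dim_vec v"
  then show "u $ i = v $ i"
    using assms(2) assms(3)[of i] assms(4)[of "i - N"] by (cases "i < N") simp_all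
qed (simp add: assms)

text \<open>\<open>u + \<sigma>u\<close> in the notation above.\<close>

definition half_diff :: "nat \<Rightarrow> bit vec \<Rightarrow> nat \<Rightarrow> bit" where
  "half_diff N u k = u $ k + u $ (N + k)"

lemma gray_map_add:
  assumes a: "a \<in> carrier_vec N" and b: "b \<in> carrier_vec N"
  defines "h \<equiv> vec N (\<lambda>k. half_diff N (gray_map a) k * half_diff N (gray_map b) k)"
  shows "gray_map (a + b) = gray_map a + gray_map b + (h @\<^sub>v h)"
proof (rule vec_eq_halvesI)
  fix k assume k: "k < N"
  have ab: "dim_vec a = N" "dim_vec b = N" using a b by auto
  note index = gray_map_index[of k a] gray_map_index[of k b] gray_map_index[of k "a + b"]
  show "gray_map (a + b) $ k = (gray_map a + gray_map b + (h @\<^sub>v h)) $ k"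
    and "gray_map (a + b) $ (N + k) = (gray_map a + gray_map b + (h @\<^sub>v h)) $ (N + k)"
    using k ab index by (simp_all add: h_def half_diff_def gray_add)
qed (use a b in \<open>auto simp: h_def\<close>)

theorem Z4_linearI:
  assumes carrier: "C \<subseteq> carrier_vec (2 * N)"
    and zero: "0\<^sub>v (2 * N) \<in> C"
    and add: "\<And>u v. u \<in> C \<Longrightarrow> v \<in> C \<Longrightarrow> u + v \<in> C"
    and prod: "\<And>u v h. u \<in> C \<Longrightarrow> v \<in> C \<Longrightarrow> h = vec N (\<lambda>k. half_diff N u k * half_diff N v k) \<Longrightarrow>
      h @\<^sub>v h \<in> C"
  shows "Z4_linear (2 * N) C"
proof -
  define D where "D = {a \<in> carrier_vec N. gray_map a \<in> C}"
  have D_carrier: "D \<subseteq> carrier_vec N" by (auto simp: D_def)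
  have D_add: "a + b \<in> D" if "a \<in> D" "b \<in> D" for a b
    using that add prod by (auto simp: D_def gray_map_add)
  interpret G: comm_group "monoid_vec TYPE(4) N" by (rule comm_group_vec)
  have "gray_map (0\<^sub>v N) = 0\<^sub>v (2 * N)"
    by (intro eq_vecI) (auto simp: gray_map_def gray_beta_values gray_gamma_values)
  then have "0\<^sub>v N \<in> D" using zero by (simp add: D_def)
  moreover have "inv\<^bsub>monoid_vec TYPE(4) N\<^esub> a \<in> D" if "a \<in> D" for a
  proof -
    have a: "a \<in> carrier_vec N" using that by (simp add: D_def)
    \<comment> \<open>Multiplication by 4 annihilates the group, so the inverse of \<open>a\<close>
      is \<open>a + a + a\<close> and closure under addition gives closure under inverses.\<close>
    have four: "x + x + x + x = 0" for x :: 4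
      using exhaust_Z4[of x] by auto
    have "a + a + a + a = 0\<^sub>v N"
      using a four by (intro eq_vecI) auto
    then have "inv\<^bsub>monoid_vec TYPE(4) N\<^esub> a = a + a + a"
      using a by (intro G.inv_equality) (simp_all add: monoid_vec_simps)
    then show ?thesis using that D_add by simp
  qed
  ultimately have "subgroup D (monoid_vec TYPE(4) N)"
    using D_add D_carrier by (intro G.subgroupI) (auto simp: monoid_vec_simps)
  moreover have "gray_map ` D = C"
  proof
    show "C \<subseteq> gray_map ` D"
    proof
      fix u assume u: "u \<in> C"
      then have dim_u: "dim_vec u = 2 * N" using carrier by auto
      \<comment> \<open>\<open>g\<close> inverts the Gray map on one coordinate; applied to the
        entries at \<open>k\<close> and \<open>N + k\<close> it builds a preimage of
        \<open>u\<close>.\<close>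
      obtain g where g: "\<And>x y. gray_beta (g x y) = x" "\<And>x y. gray_gamma (g x y) = y"
        using gray_surj by metis
      let ?a = "vec N (\<lambda>k. g (u $ k) (u $ (N + k)))"
      have "gray_map ?a = u"
        using gray_map_index[of _ ?a] by (intro vec_eq_halvesI) (simp_all add: dim_u g)
      then show "u \<in> gray_map ` D"
        using u by (auto simp: D_def intro!: image_eqI[of _ _ ?a])
    qed
  qed (auto simp: D_def)
  moreover have "permute_coords id ` C = C"
  proof -
    have "permute_coords id u = u" for u by (auto simp: permute_coords_def)
    then show ?thesis by simp
  qed
  ultimately show ?thesis
    unfolding Z4_linear_def quaternary_linear_code_def using carrier permutes_id by metis
qed

section \<open>Boolean polynomials\<close>

text \<open>The support lies in the finite set \<open>Pow {..<m}\<close>, so \<open>Max\<close> is a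
  genuine maximum, and the inserted 0 imposes no condition.\<close>

lemma bool_poly_degree_le_iff:
  assumes "f \<in> bool_polys m"
  shows "bool_poly_degree f \<le> r \<longleftrightarrow> (\<forall>S. f S \<noteq> 0 \<longrightarrow> card S \<le> r)"
proof -
  have "{S. f S \<noteq> 0} \<subseteq> Pow {..<m}" using assms by (auto simp: bool_polys_def)
  then have "finite {S. f S \<noteq> 0}" by (rule finite_subset) simp
  then show ?thesis by (auto simp: bool_poly_degree_def)
qed

lemma reed_muller_eq:
  "reed_muller r m = value_vec m ` {f \<in> bool_polys m. \<forall>S. f S \<noteq> 0 \<longrightarrow> card S \<le> r}"
  using bool_poly_degree_le_iff by (auto simp: reed_muller_def)

lemma bool_poly_eval_add:
  "bool_poly_eval (\<lambda>S. f S + g S) x = bool_poly_eval f x + bool_poly_eval g x"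
  by (simp add: bool_poly_eval_def distrib_right sum.distrib)

text \<open>
  Since \<open>x\<^sub>i\<^sup>2 = x\<^sub>i\<close>, the product of the monomials \<open>S\<close> and \<open>T\<close> is the monomial \<open>S \<union> T\<close>.
\<close>

definition bool_poly_mult :: "bool_poly \<Rightarrow> bool_poly \<Rightarrow> bool_poly" where
  "bool_poly_mult f g U = (\<Sum>(S, T) | S \<union> T = U. f S * g T)"

lemma bool_poly_mult_nonzeroE:
  assumes "bool_poly_mult f g U \<noteq> 0"
  obtains S T where "U = S \<union> T" "f S \<noteq> 0" "g T \<noteq> 0"
proof -
  obtain p where "p \<in> {(S, T). S \<union> T = U}" "(case p of (S, T) \<Rightarrow> f S * g T) \<noteq> 0"
    using assms unfolding bool_poly_mult_def by (rule sum.not_neutral_contains_not_neutral)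
  then show thesis using that by (cases p) auto
qed

lemma bool_poly_mult_in_bool_polys:
  assumes "f \<in> bool_polys m" "g \<in> bool_polys m"
  shows "bool_poly_mult f g \<in> bool_polys m"
  unfolding bool_polys_def
proof (intro CollectI allI impI)
  fix U assume "bool_poly_mult f g U \<noteq> 0"
  then obtain S T where "U = S \<union> T" "f S \<noteq> 0" "g T \<noteq> 0" by (rule bool_poly_mult_nonzeroE)
  then show "U \<subseteq> {..<m}" using assms unfolding bool_polys_def by blast
qed

text \<open>Idempotence of \<open>bit\<close>: factors in the intersection occur twice on the right
  without effect. Each product is the indicator that all its factors are 1.\<close>

lemma prod_bit_Un:
  assumes "finite S" "finite T"
  shows "prod x (S \<union> T) = prod x S * (prod x T :: bit)"
proof -
  have "prod x S = of_bool (\<forall>i\<in>S. x i = 1)" if "finite S" for S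
    using that by (induction rule: finite_induct) auto
  then show ?thesis using assms by auto
qed

text \<open>The right-hand side expands to a sum over pairs of monomials; grouping the pairs by
  their union gives the coefficients of the product.\<close>

lemma bool_poly_eval_mult:
  "bool_poly_eval (bool_poly_mult f g) x = bool_poly_eval f x * bool_poly_eval g x"
proof -
  let ?A = "Pow {..<dim_vec x}"
  let ?m = "\<lambda>S. \<Prod>i\<in>S. x $ i"
  have "bool_poly_eval (bool_poly_mult f g) x =
      (\<Sum>U\<in>?A. \<Sum>p\<in>{p \<in> ?A \<times> ?A. fst p \<union> snd p = U}. f (fst p) * g (snd p) * ?m (fst p \<union> snd p))"
    unfolding bool_poly_eval_def
  proof (rule sum.cong[OF refl])
    fix U assume "U \<in> ?A"
    then have "{(S, T). S \<union> T = U} = {p \<in> ?A \<times> ?A. fst p \<union> snd p = U}" by auto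
    then show "bool_poly_mult f g U * ?m U =
        (\<Sum>p\<in>{p \<in> ?A \<times> ?A. fst p \<union> snd p = U}. f (fst p) * g (snd p) * ?m (fst p \<union> snd p))"
      by (simp add: bool_poly_mult_def sum_distrib_right case_prod_unfold)
  qed
  also have "\<dots> = (\<Sum>p\<in>?A \<times> ?A. f (fst p) * g (snd p) * ?m (fst p \<union> snd p))"
    by (rule sum.group) auto
  also have "\<dots> = (\<Sum>(S, T)\<in>?A \<times> ?A. (f S * ?m S) * (g T * ?m T))"
  proof (rule sum.cong[OF refl])
    fix p assume "p \<in> ?A \<times> ?A"
    then have "finite (fst p)" "finite (snd p)"
      by (auto intro: finite_subset[of _ "{..<dim_vec x}"])
    then show "f (fst p) * g (snd p) * ?m (fst p \<union> snd p) =
        (case p of (S, T) \<Rightarrow> (f S * ?m S) * (g T * ?m T))"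
      by (simp add: prod_bit_Un case_prod_unfold ac_simps)
  qed
  also have "\<dots> = bool_poly_eval f x * bool_poly_eval g x"
    unfolding bool_poly_eval_def by (simp only: sum_product sum.cartesian_product)
  finally show ?thesis .
qed

text \<open>The formal partial derivative: if \<open>f = f0 + x_i * f1\<close> with
  \<open>f0\<close> and \<open>f1\<close> free of \<open>x_i\<close>, this is
  \<open>f1\<close>.\<close>

definition bool_poly_deriv :: "nat \<Rightarrow> bool_poly \<Rightarrow> bool_poly" where
  "bool_poly_deriv i f S = (if i \<in> S then 0 else f (insert i S))"

lemma bool_poly_deriv_in_bool_polys:
  assumes "f \<in> bool_polys (Suc n)"
  shows "bool_poly_deriv n f \<in> bool_polys n"
  unfolding bool_polys_def bool_poly_deriv_def
proof (intro CollectI allI impI)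
  fix S assume S: "(if n \<in> S then 0 else f (insert n S)) \<noteq> 0"
  then have "insert n S \<subseteq> {..<Suc n}" "n \<notin> S"
    using assms by (auto simp: bool_polys_def split: if_splits)
  then show "S \<subseteq> {..<n}" by (auto simp: lessThan_Suc)
qed

text \<open>This is the evaluated form of \<open>f = f0 + x_i * f1\<close>, obtained by separating
  the monomials without \<open>i\<close> from those containing \<open>i\<close>.\<close>

lemma bool_poly_eval_split:
  assumes "i < dim_vec x"
  defines "A \<equiv> Pow ({..<dim_vec x} - {i})"
  shows "bool_poly_eval f x = (\<Sum>S\<in>A. f S * (\<Prod>j\<in>S. x $ j)) +
      x $ i * (\<Sum>S\<in>A. f (insert i S) * (\<Prod>j\<in>S. x $ j))"
proof -
  have "Pow {..<dim_vec x} = Pow (insert i ({..<dim_vec x} - {i}))"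
    using assms by (simp add: insert_absorb)
  also have "\<dots> = A \<union> insert i ` A" unfolding A_def by (rule Pow_insert)
  finally have "bool_poly_eval f x = (\<Sum>S\<in>A. f S * (\<Prod>j\<in>S. x $ j)) +
      (\<Sum>S\<in>insert i ` A. f S * (\<Prod>j\<in>S. x $ j))"
    unfolding bool_poly_eval_def
    by (simp only:) (intro sum.union_disjoint, auto simp: A_def)
  also have "(\<Sum>S\<in>insert i ` A. f S * (\<Prod>j\<in>S. x $ j)) =
      (\<Sum>S\<in>A. f (insert i S) * (\<Prod>j\<in>insert i S. x $ j))"
    by (rule sum.reindex_cong[of "insert i"]) (auto simp: A_def inj_on_def)
  also have "\<dots> = (\<Sum>S\<in>A. x $ i * (f (insert i S) * (\<Prod>j\<in>S. x $ j)))"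
  proof (rule sum.cong[OF refl])
    fix S assume "S \<in> A"
    then have "finite S" "i \<notin> S" by (auto simp: A_def intro: finite_subset)
    then show "f (insert i S) * (\<Prod>j\<in>insert i S. x $ j) =
        x $ i * (f (insert i S) * (\<Prod>j\<in>S. x $ j))"
      by (simp add: ac_simps)
  qed
  finally show ?thesis by (simp only: sum_distrib_left)
qed

text \<open>Flipping \<open>x_i\<close> leaves the values of \<open>f0\<close> and \<open>f1\<close>
  fixed and changes \<open>f0 + x_i * f1\<close> by \<open>f1\<close>.\<close>

lemma bool_poly_eval_translate:
  assumes "dim_vec y = dim_vec x" "i < dim_vec x" "y $ i = x $ i + 1"
    and same: "\<And>j. j < dim_vec x \<Longrightarrow> j \<noteq> i \<Longrightarrow> y $ j = x $ j"
  shows "bool_poly_eval f y = bool_poly_eval f x + bool_poly_eval (bool_poly_deriv i f) x"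
proof -
  let ?A = "Pow ({..<dim_vec x} - {i})"
  have "(\<Prod>j\<in>S. y $ j) = (\<Prod>j\<in>S. x $ j)" if "S \<in> ?A" for S
    using that same by (intro prod.cong) auto
  then have y: "(\<Sum>S\<in>?A. g S * (\<Prod>j\<in>S. y $ j)) = (\<Sum>S\<in>?A. g S * (\<Prod>j\<in>S. x $ j))" for g
    by simp
  have "bool_poly_deriv i f S = f (insert i S)" "bool_poly_deriv i f (insert i S) = 0"
    if "S \<in> ?A" for S
    using that by (auto simp: bool_poly_deriv_def)
  then have deriv: "bool_poly_eval (bool_poly_deriv i f) x =
      (\<Sum>S\<in>?A. f (insert i S) * (\<Prod>j\<in>S. x $ j))"
    using assms(2) by (simp add: bool_poly_eval_split[of i])
  then show ?thesis
    using assms(1-3) y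
    by (simp add: deriv bool_poly_eval_split[of i x f] bool_poly_eval_split[of i y f]
        distrib_right add.assoc)
qed

section \<open>Reed-Muller codes\<close>

lemma bool_poly_eval_upper_half:
  assumes "k < 2 ^ n"
  shows "bool_poly_eval f (point (Suc n) (2 ^ n + k)) =
    bool_poly_eval f (point (Suc n) k) + bool_poly_eval (bool_poly_deriv n f) (point (Suc n) k)"
proof (rule bool_poly_eval_translate)
  \<comment> \<open>As \<open>k < 2 ^ n\<close>, adding \<open>2 ^ n\<close> sets bit
    \<open>n\<close> and keeps the lower bits: moving to the upper half flips exactly the last
    variable.\<close>
  have bit: "bit (2 ^ n + k) j \<longleftrightarrow> (if j = n then True else bit k j)" if "j \<le> n" for j
  proof (cases "j = n")
    case True
    then show ?thesis using assms by (simp add: bit_iff_odd)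
  next
    case False
    then have "take_bit n (2 ^ n + k) = take_bit n k" by (simp add: take_bit_eq_mod)
    then show ?thesis using False that by (metis bit_take_bit_iff le_neq_implies_less)
  qed
  have "\<not> bit k n" using assms by (simp add: bit_iff_odd)
  then show "point (Suc n) (2 ^ n + k) $ n = point (Suc n) k $ n + 1"
    using bit by (simp add: point_def)
  show "point (Suc n) (2 ^ n + k) $ j = point (Suc n) k $ j"
    if "j < dim_vec (point (Suc n) k)" "j \<noteq> n" for j
    using that bit by (simp add: point_def)
qed (simp_all add: point_def)

lemma reed_muller_add:
  assumes "u \<in> reed_muller r m" "v \<in> reed_muller r m"
  shows "u + v \<in> reed_muller r m"
proof -
  obtain f g where f: "u = value_vec m f" "f \<in> bool_polys m" "\<And>S. f S \<noteq> 0 \<Longrightarrow> card S \<le> r"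
    and g: "v = value_vec m g" "g \<in> bool_polys m" "\<And>S. g S \<noteq> 0 \<Longrightarrow> card S \<le> r"
    using assms by (auto simp: reed_muller_eq)
  have nz: "f S \<noteq> 0 \<or> g S \<noteq> 0" if "f S + g S \<noteq> 0" for S
    using that by (cases "f S"; cases "g S") auto
  have "u + v = value_vec m (\<lambda>S. f S + g S)"
    unfolding f(1) g(1) by (intro eq_vecI) (simp_all add: value_vec_def bool_poly_eval_add)
  moreover have "(\<lambda>S. f S + g S) \<in> bool_polys m"
    using nz f(2) g(2) unfolding bool_polys_def by blast
  moreover have "card S \<le> r" if "f S + g S \<noteq> 0" for S
    using nz[OF that] f(3) g(3) by blast
  ultimately show ?thesis unfolding reed_muller_eq by blast
qed

lemma zero_in_reed_muller: "0\<^sub>v (2 ^ m) \<in> reed_muller r m"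
proof -
  have "value_vec m (\<lambda>_. 0) = 0\<^sub>v (2 ^ m)"
    by (intro eq_vecI) (simp_all add: value_vec_def bool_poly_eval_def)
  then show ?thesis
    by (auto simp: reed_muller_eq bool_polys_def intro!: image_eqI[of _ _ "\<lambda>_. 0"])
qed

lemma half_diff_value_vec:
  assumes "k < 2 ^ n"
  shows "half_diff (2 ^ n) (value_vec (Suc n) f) k =
    bool_poly_eval (bool_poly_deriv n f) (point (Suc n) k)"
  using assms by (simp add: half_diff_def value_vec_def bool_poly_eval_upper_half)

text \<open>A polynomial free of the last variable has zero derivative in it, so its values on the
  two halves agree.\<close>

lemma value_vec_eq_append:
  assumes "f \<in> bool_polys n"
  defines "h \<equiv> vec (2 ^ n) (\<lambda>k. bool_poly_eval f (point (Suc n) k))"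
  shows "value_vec (Suc n) f = h @\<^sub>v h"
proof -
  have "n \<notin> S" if "f S \<noteq> 0" for S using assms(1) that by (auto simp: bool_polys_def)
  then have "bool_poly_deriv n f = (\<lambda>_. 0)" by (fastforce simp: bool_poly_deriv_def)
  then have "bool_poly_eval f (point (Suc n) (2 ^ n + k)) = bool_poly_eval f (point (Suc n) k)"
    if "k < 2 ^ n" for k
    using that by (simp add: bool_poly_eval_upper_half) (simp add: bool_poly_eval_def)
  then show ?thesis
    by (intro vec_eq_halvesI[of _ "2 ^ n"]) (simp_all add: h_def value_vec_def)
qed

theorem theorem2:
  fixes m r :: nat
  assumes "m \<ge> 1"
    and "r \<in> {0, 1, 2, m - 1, m}"
    and "r \<le> m"
  shows "Z4_linear (2 ^ m) (reed_muller r m)"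
proof -
  obtain n where m: "m = Suc n" using assms(1) by (cases m) auto
  have "Z4_linear (2 * 2 ^ n) (reed_muller r m)"
  proof (rule Z4_linearI)
    show "reed_muller r m \<subseteq> carrier_vec (2 * 2 ^ n)"
      by (auto simp: reed_muller_def value_vec_def m)
    show "0\<^sub>v (2 * 2 ^ n) \<in> reed_muller r m"
      using zero_in_reed_muller[of m] by (simp add: m)
  next
    fix u v h
    assume u: "u \<in> reed_muller r m" and v: "v \<in> reed_muller r m"
      and h: "h = vec (2 ^ n) (\<lambda>k. half_diff (2 ^ n) u k * half_diff (2 ^ n) v k)"
    obtain f g where f: "u = value_vec m f" "f \<in> bool_polys m" "\<And>S. f S \<noteq> 0 \<Longrightarrow> card S \<le> r"
      and g: "v = value_vec m g" "g \<in> bool_polys m" "\<And>S. g S \<noteq> 0 \<Longrightarrow> card S \<le> r"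
      using u v by (auto simp: reed_muller_eq)
    define f' g' where "f' = bool_poly_deriv n f" and "g' = bool_poly_deriv n g"
    define p where "p = bool_poly_mult f' g'"
    have f': "f' \<in> bool_polys n" and g': "g' \<in> bool_polys n"
      using f(2) g(2) by (simp_all add: m f'_def g'_def bool_poly_deriv_in_bool_polys)
    then have p: "p \<in> bool_polys n" by (simp add: p_def bool_poly_mult_in_bool_polys)
    have "h = vec (2 ^ n) (\<lambda>k. bool_poly_eval p (point m k))"
      unfolding h f(1) g(1) m p_def f'_def g'_def
      by (intro eq_vecI) (simp_all add: half_diff_value_vec bool_poly_eval_mult)
    then have "h @\<^sub>v h = value_vec m p"
      using value_vec_eq_append[OF p] by (simp add: m)
    moreover have "p \<in> bool_polys m"
      using p by (auto simp: bool_polys_def m lessThan_Suc)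
    moreover have "card U \<le> r" if U: "p U \<noteq> 0" for U
    proof -
      \<comment> \<open>The bound \<open>m - 1\<close>, which settles the cases where
        \<open>r\<close> is \<open>m - 1\<close> or \<open>m\<close>.\<close>
      have "card U \<le> card {..<n}"
        using p U by (intro card_mono) (auto simp: bool_polys_def)
      \<comment> \<open>Differentiation lowers the degree by one. Written with \<open>+ 1\<close>
        instead of \<open>r - 1\<close>, the bound also excludes any monomial when
        \<open>r = 0\<close>.\<close>
      have card_deriv: "card S + 1 \<le> r"
        if "bool_poly_deriv n q S \<noteq> 0" "q \<in> bool_polys m" "\<And>S. q S \<noteq> 0 \<Longrightarrow> card S \<le> r"
        for q S
      proof -
        have S: "n \<notin> S" "q (insert n S) \<noteq> 0"
          using that(1) by (auto simp: bool_poly_deriv_def split: if_splits)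
        then have "finite (insert n S)"
          using that(2) by (auto simp: bool_polys_def intro: finite_subset)
        then show ?thesis using that(3)[OF S(2)] S(1) by simp
      qed
      obtain S T where ST: "U = S \<union> T" "f' S \<noteq> 0" "g' T \<noteq> 0"
        using U unfolding p_def by (rule bool_poly_mult_nonzeroE)
      have "card S + 1 \<le> r" "card T + 1 \<le> r"
        using card_deriv ST f g by (simp_all add: f'_def g'_def)
      moreover have "card U \<le> card S + card T"
        using ST(1) card_Un_le by blast
      \<comment> \<open>For \<open>r = 0\<close> the bounds are contradictory; for
        \<open>r = 1\<close> and \<open>r = 2\<close> they give
        \<open>card U \<le> 2 * (r - 1) \<le> r\<close>.\<close>
      ultimately show ?thesis
        using \<open>card U \<le> card {..<n}\<close> assms(2) by (auto simp: m)
    qed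
    ultimately show "h @\<^sub>v h \<in> reed_muller r m" unfolding reed_muller_eq by blast
  qed (rule reed_muller_add)
  then show ?thesis by (simp add: m)
qed

end
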